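(* Let $q$ be a prime power and let $n,k,r$ be integers with $1\le r\le k\le n$. Then $$\mathcal{C}_q(n,k,r)\ge\left\lceil \frac{q^n-1}{q^k-1}\,\mathcal{C}_q(n-1,k-1,r-1)\right\rceil .$$
   Context: $\mathcal{G}_q(n,k)$ denotes the set of all $k$-dimensional subspaces of $\mathbb{F}_q^n$. For $0\le r\le k\le n$, a $q$-covering design $C_q[n,k,r]$ is a set $\mathbb{S}\subseteq\mathcal{G}_q(n,k)$ such that each element of $\mathcal{G}_q(n,r)$ is contained in at least one element of $\mathbb{S}$. The $q$-covering number $\mathcal{C}_q(n,k,r)$ is the minimum size of a $q$-covering design $C_q[n,k,r]$. *)

theory Defs
  imports Complex_Main "HOL-Library.Cardinality" "Jordan_Normal_Form.VS_Connect"
begin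

text \<open>
  The field with \<open>q\<close> elements is a type \<open>'a\<close> of sort \<open>{field, finite}\<close> with \<open>CARD('a) = q\<close>, and
  the space of \<open>n\<close>-dimensional vectors over it is \<open>module_vec TYPE('a) n\<close>. Only the length \<open>n\<close> is
  a term, so spaces of different dimensions can occur in one statement.
\<close>

definition grassmannian :: "'a :: {field, finite} itself \<Rightarrow> nat \<Rightarrow> nat \<Rightarrow> 'a vec set set" where
  "grassmannian ty n k =
    {W. VectorSpace.subspace (class_ring :: 'a ring) W (module_vec TYPE('a) n) \<and>
        vectorspace.dim (class_ring :: 'a ring) (module_vec TYPE('a) n\<lparr>carrier := W\<rparr>) = k}"

definition q_covering_design ::
  "'a :: {field, finite} itself \<Rightarrow> nat \<Rightarrow> nat \<Rightarrow> nat \<Rightarrow> 'a vec set set \<Rightarrow> bool" where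
  "q_covering_design ty n k r S \<longleftrightarrow>
    S \<subseteq> grassmannian ty n k \<and> (\<forall>U \<in> grassmannian ty n r. \<exists>W \<in> S. U \<subseteq> W)"

text \<open>
  Every design is finite, since \<open>carrier_vec n\<close> is, so \<open>card\<close> is its true size. The minimum exists
  for \<open>r \<le> k \<le> n\<close>, because \<open>grassmannian ty n k\<close> is then a design; outside this range the value
  is not meaningful.
\<close>

definition q_covering_number :: "'a :: {field, finite} itself \<Rightarrow> nat \<Rightarrow> nat \<Rightarrow> nat \<Rightarrow> nat" where
  "q_covering_number ty n k r = (LEAST m. \<exists>S. q_covering_design ty n k r S \<and> card S = m)"

end

theory Submission
  imports Defs
begin

text \<open>
  The inequality is the incidence count behind Schoenheim's bound. Fix a smallest design \<open>S\<close> and a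
  nonzero vector \<open>v\<close>. The members of \<open>S\<close> that contain \<open>v\<close>, taken modulo the line through \<open>v\<close>, form
  a design with parameters \<open>n - 1\<close>, \<open>k - 1\<close>, \<open>r - 1\<close>: an \<open>(r - 1)\<close>-dimensional subspace of the
  quotient comes from an \<open>r\<close>-dimensional subspace through \<open>v\<close>, and whichever member of \<open>S\<close> covers the
  latter also contains \<open>v\<close>. Hence every one of the \<open>q ^ n - 1\<close> nonzero vectors lies in at least
  \<open>q_covering_number _ (n - 1) (k - 1) (r - 1)\<close> members of \<open>S\<close>, whereas each member contains exactly
  \<open>q ^ k - 1\<close> nonzero vectors. Counting incident pairs in both ways gives the bound
  (\<open>covering_number_incidence_bound\<close>).

  Two devices keep the linear algebra short. Over a finite field a subspace has dimension \<open>k\<close> exactly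
  when it has \<open>q ^ k\<close> elements (\<open>grassmannian_iff\<close>), so dimensions are compared by counting. And the
  quotient by the line through \<open>v\<close> is realised inside the space as a coordinate hyperplane that misses
  \<open>v\<close>: passing to the quotient is intersecting with that hyperplane, and coming back is adding the
  multiples of \<open>v\<close> (locale \<open>line_complement\<close>).
\<close>

section \<open>Subspaces of a given dimension, by cardinality\<close>

text \<open>A basis identifies the space with the coefficient functions on it.\<close>

lemma (in vectorspace) card_carrier_eq_power_dim:
  assumes "fin_dim"
  shows "card (carrier V) = card (carrier K) ^ dim"
proof -
  obtain B where B: "finite B" "basis B"
    using finite_basis_exists[OF assms] by blast
  have BV: "B \<subseteq> carrier V"
    using B(2) by (simp add: basis_def)
  have unique: "\<exists>!a. a \<in> B \<rightarrow>\<^sub>E carrier K \<and> lincomb a B = x" if "x \<in> carrier V" for x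
    using basis_criterion[OF B(1) BV] B(2) that by blast
  have closed: "lincomb a B \<in> carrier V" if "a \<in> B \<rightarrow>\<^sub>E carrier K" for a
    using that BV by (intro lincomb_closed) auto
  have "bij_betw (\<lambda>a. lincomb a B) (B \<rightarrow>\<^sub>E carrier K) (carrier V)"
    unfolding bij_betw_def
  proof
    show "inj_on (\<lambda>a. lincomb a B) (B \<rightarrow>\<^sub>E carrier K)"
      using unique closed by (intro inj_onI) metis
    show "(\<lambda>a. lincomb a B) ` (B \<rightarrow>\<^sub>E carrier K) = carrier V"
      using unique closed by (auto simp: image_iff) metis
  qed
  then have "card (carrier V) = card (B \<rightarrow>\<^sub>E carrier K)"
    by (simp add: bij_betw_same_card)
  also have "\<dots> = card (carrier K) ^ card B"
    by (simp add: card_PiE B(1))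
  also have "card B = dim"
    using dim_basis[OF B] by simp
  finally show ?thesis .
qed

lemma card_carrier_vec_eq:
  "card (carrier_vec n :: 'a :: {field, finite} vec set) = CARD('a) ^ n"
proof -
  interpret vec_space "TYPE('a)" n .
  show ?thesis
    using card_carrier_eq_power_dim by (simp add: dim_is_n)
qed

lemma finite_carrier_vec: "finite (carrier_vec n :: 'a :: {field, finite} vec set)"
  by (rule card_ge_0_finite) (simp add: card_carrier_vec_eq)

lemma card_field_gt_1: "1 < CARD('a :: {field, finite})"
proof -
  have "card {0, 1 :: 'a} \<le> CARD('a)"
    by (intro card_mono) auto
  then show ?thesis by simp
qed

definition closed_vecs :: "nat \<Rightarrow> 'a :: field vec set \<Rightarrow> bool" where
  "closed_vecs n W \<longleftrightarrow> W \<subseteq> carrier_vec n \<and> 0\<^sub>v n \<in> W \<and>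
    (\<forall>x\<in>W. \<forall>y\<in>W. x + y \<in> W) \<and> (\<forall>c. \<forall>x\<in>W. c \<cdot>\<^sub>v x \<in> W)"

lemma subspace_iff_closed_vecs:
  "VectorSpace.subspace (class_ring :: 'a :: field ring) W (module_vec TYPE('a) n)
    \<longleftrightarrow> closed_vecs n W"
  using vec_vs[where 'a = 'a and n = n] vec_module[where 'a = 'a and n = n]
  unfolding VectorSpace.subspace_def submodule_def closed_vecs_def
  by (auto simp: module_vec_simps)

text \<open>As \<open>q > 1\<close>, the power \<open>q ^ k\<close> determines the exponent \<open>k\<close>.\<close>

lemma grassmannian_iff:
  fixes W :: "'a :: {field, finite} vec set"
  shows "W \<in> grassmannian TYPE('a) n k \<longleftrightarrow> closed_vecs n W \<and> card W = CARD('a) ^ k"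
proof (cases "closed_vecs n W")
  case True
  interpret V: vec_space "TYPE('a)" n .
  let ?W = "module_vec TYPE('a) n\<lparr>carrier := W\<rparr>"
  have "VectorSpace.subspace class_ring W (module_vec TYPE('a) n)"
    using True by (simp add: subspace_iff_closed_vecs)
  then interpret W: vectorspace class_ring ?W
    by (rule V.subspace_is_vs)
  have "finite W"
    using True finite_carrier_vec finite_subset unfolding closed_vecs_def by blast
  then have "W.fin_dim"
    unfolding W.fin_dim_def using W.span_is_subset2[of W] W.in_own_span[of W]
    by (intro exI[of _ W]) auto
  then have "card W = CARD('a) ^ W.dim"
    using W.card_carrier_eq_power_dim by simp
  then show ?thesis
    using True card_field_gt_1[where 'a = 'a]
    by (auto simp: grassmannian_def subspace_iff_closed_vecs)
qed (auto simp: grassmannian_def subspace_iff_closed_vecs)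

lemma finite_grassmannian: "finite (grassmannian TYPE('a :: {field, finite}) n k)"
proof (rule finite_subset)
  show "grassmannian TYPE('a) n k \<subseteq> Pow (carrier_vec n)"
    by (auto simp: grassmannian_iff closed_vecs_def)
qed (simp add: finite_carrier_vec)

section \<open>The quotient by a line, as a hyperplane\<close>

text \<open>
  The map \<open>s\<close> embeds a hyperplane that is complementary to the line spanned by \<open>v\<close>. It thereby
  stands for a section of the projection onto the quotient by that line.
\<close>

locale line_complement =
  fixes n :: nat and v :: "'a :: {field, finite} vec" and s :: "'a vec \<Rightarrow> 'a vec"
  assumes v_carrier: "v \<in> carrier_vec (Suc n)"
    and s_carrier: "y \<in> carrier_vec n \<Longrightarrow> s y \<in> carrier_vec (Suc n)"
    and s_add: "\<lbrakk>y \<in> carrier_vec n; z \<in> carrier_vec n\<rbrakk> \<Longrightarrow> s (y + z) = s y + s z"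
    and s_smult: "y \<in> carrier_vec n \<Longrightarrow> s (c \<cdot>\<^sub>v y) = c \<cdot>\<^sub>v s y"
    and decomp: "bij_betw (\<lambda>(c, y). c \<cdot>\<^sub>v v + s y) (UNIV \<times> carrier_vec n) (carrier_vec (Suc n))"
begin

text \<open>
  In terms of the quotient by the line through \<open>v\<close>, \<open>lift Y\<close> is the full preimage of \<open>Y\<close>, and
  \<open>trace W\<close> is the image of \<open>W\<close> provided that \<open>v \<in> W\<close>.
\<close>

definition lift :: "'a vec set \<Rightarrow> 'a vec set" where
  "lift Y = (\<lambda>(c, y). c \<cdot>\<^sub>v v + s y) ` (UNIV \<times> Y)"

definition trace :: "'a vec set \<Rightarrow> 'a vec set" where
  "trace W = {y \<in> carrier_vec n. s y \<in> W}"

lemma s_zero: "s (0\<^sub>v n) = 0\<^sub>v (Suc n)"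
proof -
  have "0 \<cdot>\<^sub>v 0\<^sub>v n = (0\<^sub>v n :: 'a vec)"
    by (intro eq_vecI) auto
  then have "s (0\<^sub>v n) = 0 \<cdot>\<^sub>v s (0\<^sub>v n)"
    using s_smult[of "0\<^sub>v n" 0] by simp
  also have "\<dots> = 0\<^sub>v (Suc n)"
    using s_carrier[of "0\<^sub>v n"] by (intro eq_vecI) auto
  finally show ?thesis .
qed

lemma closed_lift:
  assumes "closed_vecs n Y"
  shows "closed_vecs (Suc n) (lift Y)"
proof -
  have Y: "Y \<subseteq> carrier_vec n" "0\<^sub>v n \<in> Y"
    and add: "\<And>x y. \<lbrakk>x \<in> Y; y \<in> Y\<rbrakk> \<Longrightarrow> x + y \<in> Y"
    and smult: "\<And>c x. x \<in> Y \<Longrightarrow> c \<cdot>\<^sub>v x \<in> Y"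
    using assms by (auto simp: closed_vecs_def)
  have liftI: "c \<cdot>\<^sub>v v + s y \<in> lift Y" if "y \<in> Y" for c y
    unfolding lift_def using that by force
  have sY: "s y \<in> carrier_vec (Suc n)" if "y \<in> Y" for y
    using that Y s_carrier by auto
  have "0\<^sub>v (Suc n) = 0 \<cdot>\<^sub>v v + s (0\<^sub>v n)"
    using v_carrier by (intro eq_vecI) (auto simp: s_zero)
  then have zero: "0\<^sub>v (Suc n) \<in> lift Y"
    using liftI[OF Y(2), of 0] by simp
  have plus: "x + x' \<in> lift Y" if x: "x \<in> lift Y" and x': "x' \<in> lift Y" for x x'
  proof -
    obtain c y where cy: "y \<in> Y" "x = c \<cdot>\<^sub>v v + s y"
      using x unfolding lift_def by auto
    obtain c' y' where cy': "y' \<in> Y" "x' = c' \<cdot>\<^sub>v v + s y'"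
      using x' unfolding lift_def by auto
    have "x + x' = (c + c') \<cdot>\<^sub>v v + s (y + y')"
      using cy cy' Y sY[of y] sY[of y'] v_carrier
      by (intro eq_vecI) (auto simp: s_add subset_iff algebra_simps)
    then show ?thesis
      using liftI[OF add[OF cy(1) cy'(1)]] by simp
  qed
  have mult: "a \<cdot>\<^sub>v x \<in> lift Y" if x: "x \<in> lift Y" for a x
  proof -
    obtain c y where cy: "y \<in> Y" "x = c \<cdot>\<^sub>v v + s y"
      using x unfolding lift_def by auto
    have "a \<cdot>\<^sub>v x = (a * c) \<cdot>\<^sub>v v + s (a \<cdot>\<^sub>v y)"
      using cy Y sY[of y] v_carrier
      by (intro eq_vecI) (auto simp: s_smult subset_iff algebra_simps)
    then show ?thesis
      using liftI[OF smult[OF cy(1)]] by simp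
  qed
  have "lift Y \<subseteq> carrier_vec (Suc n)"
    unfolding lift_def using v_carrier sY by auto
  then show ?thesis
    unfolding closed_vecs_def using zero plus mult by blast
qed

lemma card_lift:
  assumes "Y \<subseteq> carrier_vec n"
  shows "card (lift Y) = CARD('a) * card Y"
proof -
  have "inj_on (\<lambda>(c, y). c \<cdot>\<^sub>v v + s y) (UNIV \<times> Y)"
    using decomp assms unfolding bij_betw_def by (blast intro: inj_on_subset)
  then show ?thesis
    unfolding lift_def by (simp add: card_image card_cartesian_product)
qed

lemma lift_in_grassmannian:
  assumes "Y \<in> grassmannian TYPE('a) n k"
  shows "lift Y \<in> grassmannian TYPE('a) (Suc n) (Suc k)"
  using assms card_lift[of Y] closed_lift[of Y] by (auto simp: grassmannian_iff closed_vecs_def)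

lemma v_in_lift:
  assumes "closed_vecs n Y"
  shows "v \<in> lift Y"
proof -
  have "v = 1 \<cdot>\<^sub>v v + s (0\<^sub>v n)"
    using v_carrier by (simp add: s_zero)
  moreover have "0\<^sub>v n \<in> Y"
    using assms by (simp add: closed_vecs_def)
  ultimately show ?thesis
    unfolding lift_def by (intro image_eqI[of _ _ "(1, 0\<^sub>v n)"]) simp_all
qed

lemma closed_trace:
  assumes "closed_vecs (Suc n) W"
  shows "closed_vecs n (trace W)"
  using assms unfolding closed_vecs_def trace_def by (auto simp: s_zero s_add s_smult)

text \<open>
  A subspace through \<open>v\<close> contains the multiples of \<open>v\<close>, so subtracting one from an element of \<open>W\<close>
  moves it into the hyperplane without leaving \<open>W\<close>.
\<close>

lemma lift_trace:
  assumes W: "closed_vecs (Suc n) W" and v: "v \<in> W"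
  shows "lift (trace W) = W"
proof
  show "lift (trace W) \<subseteq> W"
    using W v unfolding lift_def trace_def closed_vecs_def by auto
  show "W \<subseteq> lift (trace W)"
  proof
    fix x assume x: "x \<in> W"
    then have "x \<in> carrier_vec (Suc n)"
      using W by (auto simp: closed_vecs_def)
    then obtain c y where y: "y \<in> carrier_vec n" and eq: "x = c \<cdot>\<^sub>v v + s y"
      using decomp unfolding bij_betw_def by fast
    have "s y = x + (- c) \<cdot>\<^sub>v v"
      using eq v_carrier s_carrier[OF y] by (intro eq_vecI) auto
    also have "\<dots> \<in> W"
      using W x v by (auto simp: closed_vecs_def)
    finally show "x \<in> lift (trace W)"
      using y eq unfolding lift_def trace_def by force
  qed
qed

lemma trace_in_grassmannian:
  assumes W: "W \<in> grassmannian TYPE('a) (Suc n) (Suc k)" and v: "v \<in> W"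
  shows "trace W \<in> grassmannian TYPE('a) n k"
proof -
  have "closed_vecs (Suc n) W" and card_W: "card W = CARD('a) ^ Suc k"
    using W by (auto simp: grassmannian_iff)
  then have "CARD('a) * card (trace W) = CARD('a) * CARD('a) ^ k"
    using card_lift[of "trace W"] lift_trace[OF _ v] by (auto simp: trace_def)
  then show ?thesis
    using closed_trace \<open>closed_vecs (Suc n) W\<close> by (simp add: grassmannian_iff)
qed

lemma trace_mono_from_lift:
  assumes "Y \<subseteq> carrier_vec n" and "lift Y \<subseteq> W"
  shows "Y \<subseteq> trace W"
proof
  fix y assume y: "y \<in> Y"
  then have "s y = 0 \<cdot>\<^sub>v v + s y"
    using assms(1) v_carrier s_carrier[of y] by (intro eq_vecI) auto
  then have "s y \<in> lift Y"
    unfolding lift_def using y by (intro image_eqI[of _ _ "(0, y)"]) simp_all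
  then show "y \<in> trace W"
    using y assms unfolding trace_def by auto
qed

end

text \<open>
  A coordinate hyperplane does it: where \<open>v\<close> has a nonzero entry, \<open>s\<close> inserts a zero.
\<close>

lemma line_complement_exists:
  fixes v :: "'a :: {field, finite} vec"
  assumes v: "v \<in> carrier_vec (Suc n)" and nz: "v \<noteq> 0\<^sub>v (Suc n)"
  shows "\<exists>s. line_complement n v s"
proof -
  obtain i where i: "i < Suc n" "v $ i \<noteq> 0"
    using v nz by (metis carrier_vecD eq_vecI index_zero_vec)
  define s :: "'a vec \<Rightarrow> 'a vec" where
    "s y = vec (Suc n) (\<lambda>j. if j < i then y $ j else if j = i then 0 else y $ (j - 1))" for y
  have s_carrier: "s y \<in> carrier_vec (Suc n)" for y
    by (simp add: s_def)
  have surj: "(\<lambda>(c, y). c \<cdot>\<^sub>v v + s y) ` (UNIV \<times> carrier_vec n) = carrier_vec (Suc n)"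
  proof (intro equalityI subsetI)
    fix x :: "'a vec" assume x: "x \<in> carrier_vec (Suc n)"
    \<comment> \<open>The entry at \<open>i\<close> determines the multiple of \<open>v\<close>; the rest must then have a zero there.\<close>
    define c where "c = x $ i / v $ i"
    define z where "z = x - c \<cdot>\<^sub>v v"
    define y where "y = vec n (\<lambda>j. z $ (if j < i then j else Suc j))"
    have "c \<cdot>\<^sub>v v + s y = x"
      using x v i by (intro eq_vecI) (auto simp: s_def y_def z_def c_def)
    moreover have "y \<in> carrier_vec n"
      by (simp add: y_def)
    ultimately show "x \<in> (\<lambda>(c, y). c \<cdot>\<^sub>v v + s y) ` (UNIV \<times> carrier_vec n)"
      by force
  qed (use v s_carrier in auto)
  \<comment> \<open>Both sides have \<open>q ^ Suc n\<close> elements.\<close>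
  have "inj_on (\<lambda>(c, y). c \<cdot>\<^sub>v v + s y) (UNIV \<times> carrier_vec n)"
    by (rule eq_card_imp_inj_on)
      (simp_all only: surj, simp_all add: finite_carrier_vec card_cartesian_product card_carrier_vec_eq)
  then have "bij_betw (\<lambda>(c, y). c \<cdot>\<^sub>v v + s y) (UNIV \<times> carrier_vec n) (carrier_vec (Suc n))"
    using surj by (simp add: bij_betw_def)
  then have "line_complement n v s"
    using v i(1) by unfold_locales (auto simp: s_def intro!: eq_vecI)
  then show ?thesis
    by (rule exI[of _ s])
qed

section \<open>Existence of covering designs\<close>

lemma grassmannian_0: "W \<in> grassmannian TYPE('a :: {field, finite}) n 0 \<longleftrightarrow> W = {0\<^sub>v n}"
  by (auto simp: grassmannian_iff closed_vecs_def card_1_singleton_iff)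

text \<open>
  The definition of the covering number by \<open>LEAST\<close> says nothing about designs unless one exists. All
  \<open>k\<close>-dimensional subspaces together form a design because smaller subspaces extend to dimension \<open>k\<close>:
  extend modulo a line inside the given subspace (any line if that subspace is zero) and lift back.
\<close>

lemma subspace_extends:
  fixes U :: "'a :: {field, finite} vec set"
  assumes "U \<in> grassmannian TYPE('a) n r" and "r \<le> k" and "k \<le> n"
  shows "\<exists>W \<in> grassmannian TYPE('a) n k. U \<subseteq> W"
  using assms
proof (induction k arbitrary: n r U)
  case 0
  then show ?case by auto
next
  case (Suc k)
  obtain m where n: "n = Suc m"
    using Suc.prems(3) by (cases n) auto
  have U: "closed_vecs n U" and card_U: "card U = CARD('a) ^ r"
    using Suc.prems(1) by (auto simp: grassmannian_iff)
  show ?case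
  proof (cases r)
    case 0
    then have U0: "U = {0\<^sub>v n}"
      using Suc.prems(1) by (simp add: grassmannian_0)
    have "(unit_vec n 0 :: 'a vec) \<noteq> 0\<^sub>v n"
      using n by (metis index_unit_vec(2) index_zero_vec(1) zero_less_Suc zero_neq_one)
    then obtain s where "line_complement m (unit_vec n 0 :: 'a vec) s"
      using line_complement_exists[of "unit_vec n 0 :: 'a vec" m] n by auto
    then interpret line_complement m "unit_vec n 0 :: 'a vec" s .
    have "{0\<^sub>v m} \<in> grassmannian TYPE('a) m 0"
      by (simp add: grassmannian_0)
    then obtain W where W: "W \<in> grassmannian TYPE('a) m k"
      using Suc.IH[of "{0\<^sub>v m}" m 0] Suc.prems n by auto
    then have "lift W \<in> grassmannian TYPE('a) n (Suc k)"
      using lift_in_grassmannian n by simp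
    moreover from this have "U \<subseteq> lift W"
      using U0 by (simp add: grassmannian_iff closed_vecs_def)
    ultimately show ?thesis by blast
  next
    case (Suc r')
    have "U \<noteq> {0\<^sub>v n}"
      using card_U Suc card_field_gt_1[where 'a = 'a] by auto
    then obtain v where v: "v \<in> U" "v \<noteq> 0\<^sub>v n"
      using U unfolding closed_vecs_def by blast
    then obtain s where "line_complement m v s"
      using line_complement_exists[of v m] U n by (auto simp: closed_vecs_def)
    then interpret line_complement m v s .
    have "trace U \<in> grassmannian TYPE('a) m r'"
      using trace_in_grassmannian v(1) Suc.prems(1) Suc n by simp
    then obtain W where W: "W \<in> grassmannian TYPE('a) m k" "trace U \<subseteq> W"
      using Suc.IH[of "trace U" m r'] Suc.prems Suc n by auto
    have "U = lift (trace U)"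
      using lift_trace U v(1) n by simp
    also have "\<dots> \<subseteq> lift W"
      using W(2) unfolding lift_def by blast
    finally show ?thesis
      using lift_in_grassmannian[OF W(1)] n by blast
  qed
qed

lemma covering_number_attained:
  assumes "r \<le> k" and "k \<le> n"
  shows "\<exists>S. q_covering_design TYPE('a :: {field, finite}) n k r S \<and>
    card S = q_covering_number TYPE('a) n k r"
proof -
  have "q_covering_design TYPE('a) n k r (grassmannian TYPE('a) n k)"
    using subspace_extends assms by (auto simp: q_covering_design_def)
  then have "\<exists>m S. q_covering_design TYPE('a) n k r S \<and> card S = m"
    by blast
  then show ?thesis
    unfolding q_covering_number_def by (rule LeastI_ex)
qed

lemma covering_number_le:
  assumes "q_covering_design TYPE('a :: {field, finite}) n k r S"
  shows "q_covering_number TYPE('a) n k r \<le> card S"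
  unfolding q_covering_number_def using assms by (intro Least_le) blast

section \<open>Counting incidences\<close>

text \<open>
  The traces of the members through \<open>v\<close> are a design in dimension \<open>n\<close>: to cover \<open>U\<close>, cover \<open>lift U\<close> by
  a member of \<open>S\<close>. Since \<open>v\<close> lies in \<open>lift U\<close>, it lies in that member too.
\<close>

lemma covering_number_le_degree:
  fixes v :: "'a :: {field, finite} vec"
  assumes S: "q_covering_design TYPE('a) (Suc n) (Suc k) (Suc r) S"
    and v: "v \<in> carrier_vec (Suc n)" "v \<noteq> 0\<^sub>v (Suc n)"
  shows "q_covering_number TYPE('a) n k r \<le> card {W \<in> S. v \<in> W}"
proof -
  obtain s where "line_complement n v s"
    using line_complement_exists v by blast
  then interpret line_complement n v s .
  have SG: "S \<subseteq> grassmannian TYPE('a) (Suc n) (Suc k)"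
    using S by (simp add: q_covering_design_def)
  have "q_covering_design TYPE('a) n k r (trace ` {W \<in> S. v \<in> W})"
    unfolding q_covering_design_def
  proof (intro conjI ballI)
    show "trace ` {W \<in> S. v \<in> W} \<subseteq> grassmannian TYPE('a) n k"
      using SG trace_in_grassmannian by auto
  next
    fix U assume U: "U \<in> grassmannian TYPE('a) n r"
    then obtain W where W: "W \<in> S" "lift U \<subseteq> W"
      using S lift_in_grassmannian unfolding q_covering_design_def by blast
    have "v \<in> W"
      using v_in_lift U W(2) by (auto simp: grassmannian_iff)
    moreover have "U \<subseteq> trace W"
      using trace_mono_from_lift W(2) U by (auto simp: grassmannian_iff closed_vecs_def)
    ultimately show "\<exists>W \<in> trace ` {W \<in> S. v \<in> W}. U \<subseteq> W"
      using W(1) by blast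
  qed
  then have "q_covering_number TYPE('a) n k r \<le> card (trace ` {W \<in> S. v \<in> W})"
    by (rule covering_number_le)
  also have "\<dots> \<le> card {W \<in> S. v \<in> W}"
    using finite_subset[OF SG finite_grassmannian] by (intro card_image_le) auto
  finally show ?thesis .
qed

lemma covering_number_incidence_bound:
  assumes "r \<le> k" and "k \<le> n"
  shows "(CARD('a :: {field, finite}) ^ Suc n - 1) * q_covering_number TYPE('a) n k r
    \<le> (CARD('a) ^ Suc k - 1) * q_covering_number TYPE('a) (Suc n) (Suc k) (Suc r)"
proof -
  let ?X = "carrier_vec (Suc n) - {0\<^sub>v (Suc n)} :: 'a vec set"
  obtain S where S: "q_covering_design TYPE('a) (Suc n) (Suc k) (Suc r) S"
    and card_S: "card S = q_covering_number TYPE('a) (Suc n) (Suc k) (Suc r)"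
    using covering_number_attained[of "Suc r" "Suc k" "Suc n"] assms by auto
  have SG: "S \<subseteq> grassmannian TYPE('a) (Suc n) (Suc k)"
    using S by (simp add: q_covering_design_def)
  have fin_S: "finite S"
    using finite_subset[OF SG finite_grassmannian] .
  have fin_X: "finite ?X"
    by (simp add: finite_carrier_vec)
  have card_X: "card ?X = CARD('a) ^ Suc n - 1"
    by (subst card_Diff_singleton) (simp_all add: card_carrier_vec_eq)
  have block: "card {v \<in> ?X. v \<in> W} = CARD('a) ^ Suc k - 1" if "W \<in> S" for W
  proof -
    have W: "closed_vecs (Suc n) W" "card W = CARD('a) ^ Suc k"
      using that SG by (auto simp: grassmannian_iff)
    then have "{v \<in> ?X. v \<in> W} = W - {0\<^sub>v (Suc n)}"
      by (auto simp: closed_vecs_def)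
    then show ?thesis
      using W by (simp add: closed_vecs_def)
  qed
  have "(CARD('a) ^ Suc n - 1) * q_covering_number TYPE('a) n k r
      = (\<Sum>v\<in>?X. q_covering_number TYPE('a) n k r)"
    unfolding sum_constant card_X by simp
  also have "\<dots> \<le> (\<Sum>v\<in>?X. card {W \<in> S. v \<in> W})"
    using covering_number_le_degree[OF S] by (intro sum_mono) auto
  also have "\<dots> = (CARD('a) ^ Suc k - 1) * card S"
    by (rule sum_multicount[OF fin_X fin_S]) (use block in blast)
  finally show ?thesis
    by (simp only: card_S)
qed

theorem theorem8:
  fixes q n k r :: nat
  assumes "q = CARD('a :: {field, finite})"
    and "1 \<le> r" and "r \<le> k" and "k \<le> n"
  shows "int (q_covering_number TYPE('a) n k r) \<ge>
    \<lceil>(real q ^ n - 1) / (real q ^ k - 1)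
      * real (q_covering_number TYPE('a) (n - 1) (k - 1) (r - 1))\<rceil>"
proof -
  let ?C = "q_covering_number TYPE('a) n k r"
  let ?C' = "q_covering_number TYPE('a) (n - 1) (k - 1) (r - 1)"
  have q: "1 < q"
    using assms(1) card_field_gt_1[where 'a = 'a] by simp
  have "(q ^ n - 1) * ?C' \<le> (q ^ k - 1) * ?C"
    using covering_number_incidence_bound[of "r - 1" "k - 1" "n - 1", where 'a = 'a] assms by simp
  then have "real ((q ^ n - 1) * ?C') \<le> real ((q ^ k - 1) * ?C)"
    by (rule of_nat_mono)
  then have "(real q ^ n - 1) * real ?C' \<le> (real q ^ k - 1) * real ?C"
    using q by (simp add: of_nat_diff)
  moreover have "0 < real q ^ k - 1"
    using q assms by (simp add: one_less_power)
  ultimately have "(real q ^ n - 1) / (real q ^ k - 1) * real ?C' \<le> real ?C"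
    by (simp add: field_simps)
  then show ?thesis
    by (simp add: ceiling_le_iff)
qed

end
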